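(* Let $A=\begin{pmatrix}a&b\\c&d\end{pmatrix}$ be a real matrix with $|A|=ad-bc>0$, $a\ge0$, $A^{-1}=\begin{pmatrix}\alpha&\beta\\ \gamma&\delta\end{pmatrix}$, $K=\gamma^2-\delta^2$. For $\psi_0\in\mathbb R$ let $\psi(t)$ be the solution of $\dot\psi=\delta\cosh\psi+\gamma\sinh\psi$, $\psi(0)=\psi_0$. Then the Cauchy problem $$\dot x=y(\alpha\cosh\psi+\beta\sinh\psi),\quad x(0)=0,\qquad \dot y=y(\gamma\cosh\psi+\delta\sinh\psi),\quad y(0)=1,$$ has the following solution (on the maximal interval of existence of $\psi$). (1) If $K<0$, then $$x(t)=\cos\rho\left(\lambda(\tan\tau-\tan\rho)+\nu\left(\frac1{\cos\tau}-\frac1{\cos\rho}\right)\right),\qquad y(t)=\frac{\cos\rho}{\cos\tau},$$ where $\rho=\arctan\sinh(\psi_0+\theta)$ and $\tau=\rho+\Delta t\in(-\frac\pi2,\frac\pi2)$. The curve $(x(t),y(t))$ is an arc of a hyperbola $y^2-(w+\sin\rho)^2=\cos^2\rho$, where $w=\frac{x-\nu(y-1)}{\lambda}$. (2) Let $K>0$. (2.1) If $\psi_0+\theta=0$, then $x(t)=-\nu(e^\sigma-1)$, $y(t)=e^\sigma$, $\sigma=s_1\Delta t$. The curve $(x(t),y(t))$ is a line $x+\nu(y-1)=0$. (2.2) If $\psi_0+\theta\ne0$, then $$x(t)=\sinh\rho\left(\nu\left(\frac1{\sinh\rho}-\frac1{\sinh\tau}\right)+s_2\lambda(\coth\tau-\coth\rho)\right),\qquad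 y(t)=\frac{\sinh\rho}{\sinh\tau},$$ where $\rho=\operatorname{arcoth}\cosh(\psi_0+\theta)$, $\tau=\rho-s_1\Delta t>0$, $s_2=\operatorname{sgn}\mu_0$, $\mu_0=\psi_0+\theta$. The curve $(x(t),y(t))$ is an arc of a hyperbola $(s_2w+\cosh\rho)^2-y^2=\sinh^2\rho$, where $w=\frac{x+\nu(y-1)}{\lambda}$. (3) If $K=0$, then $$x(t)=\rho\left(f(\tau-\rho)+\mathsf g\left(\frac1\rho-\frac1\tau\right)\right),\qquad y(t)=\frac\rho\tau,$$ where $f=-\frac{\alpha-s_1\beta}{2\gamma}$, $\mathsf g=-\frac{\alpha+s_1\beta}{2\gamma}$, $s_1=\operatorname{sgn}\gamma$, $\rho=e^{-s_1\psi_0}$, $\tau=\rho-\gamma t>0$. The curve $(x(t),y(t))$ is an arc of a hyperbola $w=\rho^2\left(\frac1y-1\right)$, where $w=\frac{x+\mathsf g(y-1)}{f}$.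
   Context: These ODEs describe arclength-parametrized timelike normal geodesics starting at $\mathrm{Id}=(0,1)$ of a left-invariant Lorentzian structure on the group $\mathrm{Aff}_+(\mathbb R)=\{(x,y):y>0\}$; only the ODE data are needed for the claim. Standing assumption of the paper: $a\ge0$, equivalently $\delta\ge0$. Constants. If $K<0$: $\Delta=\sqrt{\delta^2-\gamma^2}$ and $\theta$ is defined by $\delta=\Delta\cosh\theta$, $\gamma=\Delta\sinh\theta$. If $K>0$: $\Delta=\sqrt{\gamma^2-\delta^2}$, $s_1=\operatorname{sgn}\gamma$, and $\theta$ is defined by $\gamma=s_1\Delta\cosh\theta$, $\delta=s_1\Delta\sinh\theta$. In both cases $\lambda=\frac{\alpha\delta-\beta\gamma}{\Delta^2}$, $\nu=\frac{\beta\delta-\alpha\gamma}{\Delta^2}$. $\operatorname{arcoth}$ denotes the inverse of $\coth:(0,\infty)\to(1,\infty)$.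
   Formalization: In case (2.2) the sign is corrected to s_2 = -sgn μ_0, in both the formula for x and the hyperbola; with the printed s_2 = sgn μ_0 the formula for x is false for every t ≠ 0 (e.g. A = (0 1; -1 0), ψ_0 > 0). *)

theory Defs
  imports "HOL-Analysis.Analysis"
begin

definition coth :: "real \<Rightarrow> real" where
  "coth x = cosh x / sinh x"

definition arcoth :: "real \<Rightarrow> real" where
  "arcoth = the_inv_into {0<..} coth"

text \<open>Initial value problem \<open>u' = F t u\<close>, \<open>u(0) = u0\<close>. The interval \<open>I\<close> is open, so the
  derivatives are two-sided and the values of \<open>u\<close> outside \<open>I\<close> are irrelevant.\<close>

definition ivp_solution ::
  "(real \<Rightarrow> 'a \<Rightarrow> 'a) \<Rightarrow> 'a \<Rightarrow> real set \<Rightarrow> (real \<Rightarrow> 'a::real_normed_vector) \<Rightarrow> bool" where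
  "ivp_solution F u0 I u \<longleftrightarrow>
     open I \<and> is_interval I \<and> 0 \<in> I \<and> u 0 = u0 \<and>
     (\<forall>t\<in>I. (u has_vector_derivative F t (u t)) (at t))"

definition maximal_ivp_solution ::
  "(real \<Rightarrow> 'a \<Rightarrow> 'a) \<Rightarrow> 'a \<Rightarrow> real set \<Rightarrow> (real \<Rightarrow> 'a::real_normed_vector) \<Rightarrow> bool" where
  "maximal_ivp_solution F u0 I u \<longleftrightarrow>
     ivp_solution F u0 I u \<and>
     (\<forall>J v. ivp_solution F u0 J v \<longrightarrow> I \<subseteq> J \<longrightarrow> (\<forall>t\<in>I. v t = u t) \<longrightarrow> J = I)"

definition unique_ivp_solution ::
  "(real \<Rightarrow> 'a \<Rightarrow> 'a) \<Rightarrow> 'a \<Rightarrow> real set \<Rightarrow> (real \<Rightarrow> 'a::real_normed_vector) \<Rightarrow> bool" where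
  "unique_ivp_solution F u0 I u \<longleftrightarrow>
     ivp_solution F u0 I u \<and>
     (\<forall>v. ivp_solution F u0 I v \<longrightarrow> (\<forall>t\<in>I. v t = u t))"

definition psi_field :: "real \<Rightarrow> real \<Rightarrow> real \<Rightarrow> real \<Rightarrow> real" where
  "psi_field \<gamma> \<delta> = (\<lambda>t p. \<delta> * cosh p + \<gamma> * sinh p)"

definition xy_field ::
  "real \<Rightarrow> real \<Rightarrow> real \<Rightarrow> real \<Rightarrow> (real \<Rightarrow> real) \<Rightarrow> real \<Rightarrow> real \<times> real \<Rightarrow> real \<times> real" where
  "xy_field \<alpha> \<beta> \<gamma> \<delta> \<psi> = (\<lambda>t (x, y).
     (y * (\<alpha> * cosh (\<psi> t) + \<beta> * sinh (\<psi> t)),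
      y * (\<gamma> * cosh (\<psi> t) + \<delta> * sinh (\<psi> t))))"

text \<open>A hyperbola is the preimage of \<open>u\<^sup>2 - v\<^sup>2 = 1\<close> (both branches) under an invertible
  affine map of the plane.\<close>

definition is_hyperbola :: "(real \<times> real) set \<Rightarrow> bool" where
  "is_hyperbola H \<longleftrightarrow>
     (\<exists>p q r p' q' r'. p * q' - q * p' \<noteq> 0 \<and>
        H = {(X, Y). (p * X + q * Y + r)\<^sup>2 - (p' * X + q' * Y + r')\<^sup>2 = 1})"

definition arc_of_hyperbola ::
  "real set \<Rightarrow> (real \<Rightarrow> real \<times> real) \<Rightarrow> (real \<times> real) set \<Rightarrow> bool" where
  "arc_of_hyperbola I c H \<longleftrightarrow>
     is_hyperbola H \<and> is_interval I \<and> continuous_on I c \<and> inj_on c I \<and> c ` I \<subseteq> H"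

text \<open>Two conventions for what follows.

  A range condition on \<open>\<tau>\<close> is read as describing the maximal interval of existence \<open>I\<close> of \<open>\<psi>\<close>.
  The group consists of the points with \<open>y > 0\<close>, so that a line in it is a Euclidean line
  intersected with this half-plane.

  For \<open>K > 0\<close> and \<open>\<mu>0 \<noteq> 0\<close> the sign in the formulas for \<open>x\<close> and for the hyperbola must be
  \<open>s2 = - sgn \<mu>0\<close>. With \<open>\<psi> = \<mu> - \<theta>\<close> one has \<open>coth \<tau> = cosh \<mu>\<close>, \<open>sinh \<mu> = sgn \<mu>0 / sinh \<tau>\<close>
  and \<open>\<alpha> cosh \<psi> + \<beta> sinh \<psi> = - s1 \<Delta> (\<nu> cosh \<mu> + \<lambda> sinh \<mu>)\<close>, and with \<open>\<tau>' = - s1 \<Delta>\<close> therefore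
  \<open>x' = \<tau>' sinh \<rho> (\<nu> cosh \<tau> + sgn \<mu>0 \<lambda>) / sinh\<^sup>2 \<tau>\<close>, in which the \<open>\<lambda>\<close>-term integrates to
  \<open>- sgn \<mu>0 \<lambda> sinh \<rho> (coth \<tau> - coth \<rho>)\<close>. The choice \<open>s2 = sgn \<mu>0\<close> would be wrong for every \<open>t \<noteq> 0\<close>.\<close>

end

theory Submission
  imports Defs
begin

text \<open>
  The angle equation is solved by an elementary first integral in each case.  Writing
  \<open>\<mu> = \<psi> + \<theta>\<close>, the addition formulas turn it into \<open>\<mu>' = \<Delta> cosh \<mu>\<close> if \<open>K < 0\<close> and into
  \<open>\<mu>' = \<kappa> sinh \<mu>\<close> with \<open>\<kappa> = s\<^sub>1 \<Delta>\<close> if \<open>K > 0\<close>; for \<open>K = 0\<close> it reads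
  \<open>\<psi>' = \<delta> exp (s\<^sub>1 \<psi>)\<close>.  Hence \<open>arctan (sinh \<mu>)\<close> grows with slope \<open>\<Delta>\<close>, \<open>tanh (\<mu> / 2)\<close> is a
  multiple of \<open>exp (\<kappa> t)\<close>, and \<open>exp (- s\<^sub>1 \<psi>)\<close> has slope \<open>- \<gamma>\<close>.  The limited range of these
  functions confines the interval of existence to the claimed range of \<open>\<tau>\<close>, and inverting them
  gives a solution on all of that range.  As the given solution agrees with this one where it is
  defined, maximality forces equality of the two intervals
  (\<open>maximal_ivp_solution_interval\<close>).

  Once \<open>\<psi>\<close> is known, the system for \<open>(x, y)\<close> is linear and triangular: quotients of two
  \<open>y\<close>-components and then differences of two \<open>x\<close>-components have derivative zero
  (\<open>xy_unique_solution\<close>), so that only the displayed formulas need to be differentiated.  Their shape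
  for \<open>K \<noteq> 0\<close> comes from writing the first row of the inverse matrix as a combination of the
  second row and the swapped second row, with coefficients \<open>\<plusminus>\<nu>\<close> and \<open>\<plusminus>\<lambda>\<close>
  (\<open>row_decomposition\<close>), which means \<open>x' = \<plusminus> y (\<lambda> \<psi>' + \<nu> y' / y)\<close>.  The \<open>\<nu>\<close>-part integrates
  to a multiple of \<open>y - 1\<close>, so \<open>w\<close> isolates the \<open>\<lambda>\<close>-part of \<open>x\<close>, and the equations of the
  hyperbolas become \<open>1 / cos\<^sup>2 \<tau> - tan\<^sup>2 \<tau> = 1\<close> and \<open>coth\<^sup>2 \<tau> - 1 / sinh\<^sup>2 \<tau> = 1\<close>, multiplied by
  \<open>cos\<^sup>2 \<rho>\<close> and \<open>sinh\<^sup>2 \<rho>\<close>.  For \<open>K = 0\<close> the same elimination of \<open>y - 1\<close> leaves a function affine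
  in \<open>\<tau> = \<rho> / y\<close>, which gives a hyperbola with an asymptote \<open>y = 0\<close>.
\<close>

section \<open>Initial value problems\<close>

lemma ivp_solutionD:
  assumes "ivp_solution F u0 I u"
  shows "open I" "is_interval I" "0 \<in> I" "u 0 = u0"
    "t \<in> I \<Longrightarrow> (u has_vector_derivative F t (u t)) (at t)"
  using assms by (auto simp: ivp_solution_def)

text \<open>
  Once the maximal solution is known to follow the explicit solution \<open>v\<close> wherever it is defined,
  \<open>v\<close> is an extension of it, and a maximal solution has no proper extension.
\<close>

lemma maximal_ivp_solution_interval:
  assumes "maximal_ivp_solution F u0 I u" and "ivp_solution F u0 J v"
    and "\<And>t. t \<in> I \<Longrightarrow> t \<in> J \<and> u t = v t"
  shows "I = J"
proof -
  have "I \<subseteq> J" "\<forall>t\<in>I. v t = u t"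
    using assms(3) by auto
  then show ?thesis
    using assms(1,2) unfolding maximal_ivp_solution_def by blast
qed

lemma zero_derivative_constant_on_interval:
  fixes g :: "real \<Rightarrow> real"
  assumes "is_interval I" "s \<in> I" "t \<in> I"
    and "\<And>t. t \<in> I \<Longrightarrow> (g has_real_derivative 0) (at t)"
  shows "g t = g s"
proof -
  have "\<exists>c. \<forall>x\<in>I. g x = c"
    by (rule has_field_derivative_zero_constant)
      (use assms in \<open>auto simp: is_interval_convex_1 intro: has_field_derivative_at_within\<close>)
  then show ?thesis
    using assms by auto
qed

lemma psi_solution_derivative:
  assumes "ivp_solution (psi_field \<gamma> \<delta>) \<psi>0 I \<psi>" "t \<in> I"
  shows "(\<psi> has_real_derivative \<delta> * cosh (\<psi> t) + \<gamma> * sinh (\<psi> t)) (at t)"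
  using ivp_solutionD(5)[OF assms]
  by (simp add: psi_field_def has_real_derivative_iff_has_vector_derivative)

lemma psi_solutionI:
  assumes "open I" "is_interval I" "0 \<in> I" "\<phi> 0 = \<psi>0"
    and "\<And>t. t \<in> I \<Longrightarrow>
      (\<phi> has_real_derivative \<delta> * cosh (\<phi> t) + \<gamma> * sinh (\<phi> t)) (at t)"
  shows "ivp_solution (psi_field \<gamma> \<delta>) \<psi>0 I \<phi>"
  using assms
  by (simp add: ivp_solution_def psi_field_def has_real_derivative_iff_has_vector_derivative)

text \<open>
  The second equation is linear homogeneous in \<open>y\<close>, so any other solution has a constant
  quotient by the nowhere vanishing \<open>y\<close>.  With equal \<open>y\<close>-components the two \<open>x\<close>-components have
  the same derivative.
\<close>

lemma xy_unique_solution: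
  assumes I: "open I" "is_interval I" "0 \<in> I"
    and init: "x 0 = 0" "y 0 = 1"
    and nz: "\<And>t. t \<in> I \<Longrightarrow> y t \<noteq> 0"
    and dx: "\<And>t. t \<in> I \<Longrightarrow>
      (x has_real_derivative y t * (\<alpha> * cosh (\<psi> t) + \<beta> * sinh (\<psi> t))) (at t)"
    and dy: "\<And>t. t \<in> I \<Longrightarrow>
      (y has_real_derivative y t * (\<gamma> * cosh (\<psi> t) + \<delta> * sinh (\<psi> t))) (at t)"
  shows "unique_ivp_solution (xy_field \<alpha> \<beta> \<gamma> \<delta> \<psi>) (0, 1) I (\<lambda>t. (x t, y t))"
  unfolding unique_ivp_solution_def
proof (intro conjI allI impI ballI)
  show "ivp_solution (xy_field \<alpha> \<beta> \<gamma> \<delta> \<psi>) (0, 1) I (\<lambda>t. (x t, y t))"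
    using assms unfolding ivp_solution_def
    by (auto simp: xy_field_def has_real_derivative_iff_has_vector_derivative
        intro!: has_vector_derivative_Pair)
next
  fix v t
  assume v: "ivp_solution (xy_field \<alpha> \<beta> \<gamma> \<delta> \<psi>) (0, 1) I v" and t: "t \<in> I"
  define X Y where "X = (\<lambda>t. fst (v t))" and "Y = (\<lambda>t. snd (v t))"
  have v_eq: "v t = (X t, Y t)" for t
    by (simp add: X_def Y_def)
  have v0: "X 0 = 0" "Y 0 = 1"
    using ivp_solutionD(4)[OF v] by (auto simp: X_def Y_def)
  have dX: "(X has_real_derivative Y t * (\<alpha> * cosh (\<psi> t) + \<beta> * sinh (\<psi> t))) (at t)"
    and dY: "(Y has_real_derivative Y t * (\<gamma> * cosh (\<psi> t) + \<delta> * sinh (\<psi> t))) (at t)"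
    if "t \<in> I" for t
    using bounded_linear.has_vector_derivative[OF bounded_linear_fst ivp_solutionD(5)[OF v that]]
      bounded_linear.has_vector_derivative[OF bounded_linear_snd ivp_solutionD(5)[OF v that]]
    by (simp_all add: has_real_derivative_iff_has_vector_derivative xy_field_def v_eq)
  have Y: "Y t = y t" if "t \<in> I" for t
  proof -
    have "((\<lambda>t. Y t / y t) has_real_derivative 0) (at t)" if "t \<in> I" for t
      by (rule derivative_eq_intros dY dy that nz)+ (simp add: nz that)
    then have "Y t / y t = Y 0 / y 0"
      using I that by (intro zero_derivative_constant_on_interval[where I = I]) auto
    then show ?thesis
      using nz[OF that] v0 init by simp
  qed
  have "((\<lambda>t. X t - x t) has_real_derivative 0) (at t)" if "t \<in> I" for t
    by (rule derivative_eq_intros dX dx that)+ (simp add: Y that)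
  then have "X t - x t = X 0 - x 0"
    using I t by (intro zero_derivative_constant_on_interval[where I = I]) auto
  then show "v t = (x t, y t)"
    using v0 init Y[OF t] by (simp add: v_eq)
qed

section \<open>Hyperbolas\<close>

lemma arc_of_hyperbolaI:
  assumes "is_hyperbola H" "unique_ivp_solution F u0 I c" "inj_on c I" "\<And>t. t \<in> I \<Longrightarrow> c t \<in> H"
  shows "arc_of_hyperbola I c H"
proof -
  have "ivp_solution F u0 I c"
    using assms(2) by (simp add: unique_ivp_solution_def)
  then have "is_interval I" "continuous_on I c"
    by (auto simp: ivp_solution_def
        intro!: continuous_at_imp_continuous_on has_vector_derivative_continuous)
  then show ?thesis
    using assms unfolding arc_of_hyperbola_def by auto
qed

text \<open>
  Division by \<open>k\<^sup>2\<close> brings the equation to normal form.  The coordinate change is invertible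
  because \<open>X\<close> occurs in only one of the two affine forms and \<open>Y\<close> occurs in the other.
\<close>

lemma is_hyperbola_vertical:
  fixes l k :: real
  assumes "l \<noteq> 0" "k \<noteq> 0"
  shows "is_hyperbola {(X, Y). Y\<^sup>2 - ((X - \<nu> * (Y - 1)) / l + m)\<^sup>2 = k\<^sup>2}"
proof -
  have "Y\<^sup>2 - ((X - \<nu> * (Y - 1)) / l + m)\<^sup>2 = k\<^sup>2 \<longleftrightarrow>
    (0 * X + (1 / k) * Y + 0)\<^sup>2
      - ((1 / (l * k)) * X + (- \<nu> / (l * k)) * Y + (\<nu> / l + m) / k)\<^sup>2 = 1" for X Y
  proof -
    have "(1 / (l * k)) * X + (- \<nu> / (l * k)) * Y + (\<nu> / l + m) / k
      = ((X - \<nu> * (Y - 1)) / l + m) / k"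
      using assms by (simp add: field_simps)
    then show ?thesis
      using assms by (auto simp: power_divide simp flip: diff_divide_distrib)
  qed
  moreover have "0 * (- \<nu> / (l * k)) - (1 / k) * (1 / (l * k)) \<noteq> 0"
    using assms by simp
  ultimately show ?thesis
    unfolding is_hyperbola_def by blast
qed

lemma is_hyperbola_horizontal:
  fixes l k s :: real
  assumes "l \<noteq> 0" "k \<noteq> 0" "s \<noteq> 0"
  shows "is_hyperbola {(X, Y). (s * ((X + \<nu> * (Y - 1)) / l) + m)\<^sup>2 - Y\<^sup>2 = k\<^sup>2}"
proof -
  have "(s * ((X + \<nu> * (Y - 1)) / l) + m)\<^sup>2 - Y\<^sup>2 = k\<^sup>2 \<longleftrightarrow>
    ((s / (l * k)) * X + (s * \<nu> / (l * k)) * Y + (m - s * \<nu> / l) / k)\<^sup>2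
      - (0 * X + (1 / k) * Y + 0)\<^sup>2 = 1" for X Y
  proof -
    have "(s / (l * k)) * X + (s * \<nu> / (l * k)) * Y + (m - s * \<nu> / l) / k
      = (s * ((X + \<nu> * (Y - 1)) / l) + m) / k"
      using assms by (simp add: field_simps)
    then show ?thesis
      using assms by (auto simp: power_divide simp flip: diff_divide_distrib)
  qed
  moreover have "(s / (l * k)) * (1 / k) - (s * \<nu> / (l * k)) * 0 \<noteq> 0"
    using assms by simp
  ultimately show ?thesis
    unfolding is_hyperbola_def by blast
qed

text \<open>
  The equation says \<open>Y V = 1\<close> for an affine form \<open>V\<close> that together with \<open>Y\<close> gives affine
  coordinates of the plane, and this product equation excludes \<open>Y = 0\<close> by itself.  The coordinates \<open>(Y + V) / 2\<close> and \<open>(Y - V) / 2\<close> turn the product into a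
  difference of squares.
\<close>

lemma is_hyperbola_rectangular:
  fixes f r :: real
  assumes "f \<noteq> 0" "r \<noteq> 0"
  shows "is_hyperbola {(X, Y). Y \<noteq> 0 \<and> (X + g * (Y - 1)) / f = r\<^sup>2 * (1 / Y - 1)}"
proof -
  define V where "V X Y = (X + g * (Y - 1)) / (f * r\<^sup>2) + 1" for X Y
  have "Y \<noteq> 0 \<and> (X + g * (Y - 1)) / f = r\<^sup>2 * (1 / Y - 1) \<longleftrightarrow>
    ((1 / (2 * f * r\<^sup>2)) * X + ((1 + g / (f * r\<^sup>2)) / 2) * Y + (1 - g / (f * r\<^sup>2)) / 2)\<^sup>2
      - ((- 1 / (2 * f * r\<^sup>2)) * X + ((1 - g / (f * r\<^sup>2)) / 2) * Y
          + (g / (f * r\<^sup>2) - 1) / 2)\<^sup>2 = 1" for X Y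
  proof -
    have "(1 / (2 * f * r\<^sup>2)) * X + ((1 + g / (f * r\<^sup>2)) / 2) * Y + (1 - g / (f * r\<^sup>2)) / 2
      = (Y + V X Y) / 2"
      unfolding V_def using assms by (simp add: field_simps)
    moreover have "(- 1 / (2 * f * r\<^sup>2)) * X + ((1 - g / (f * r\<^sup>2)) / 2) * Y
        + (g / (f * r\<^sup>2) - 1) / 2 = (Y - V X Y) / 2"
      unfolding V_def using assms by (simp add: field_simps)
    moreover have "((Y + V X Y) / 2)\<^sup>2 - ((Y - V X Y) / 2)\<^sup>2 = Y * V X Y"
      by (simp add: power2_eq_square field_simps)
    moreover have "Y \<noteq> 0 \<and> (X + g * (Y - 1)) / f = r\<^sup>2 * (1 / Y - 1) \<longleftrightarrow> Y * V X Y = 1"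
    proof -
      have W: "(X + g * (Y - 1)) / f = r\<^sup>2 * (V X Y - 1)"
        unfolding V_def using assms by simp
      have "(X + g * (Y - 1)) / f = r\<^sup>2 * (1 / Y - 1) \<longleftrightarrow> V X Y = 1 / Y"
        unfolding W using assms by simp
      then show ?thesis
        by (cases "Y = 0") (auto simp: field_simps)
    qed
    ultimately show ?thesis
      by presburger
  qed
  moreover have "(1 / (2 * f * r\<^sup>2)) * ((1 - g / (f * r\<^sup>2)) / 2)
      - ((1 + g / (f * r\<^sup>2)) / 2) * (- 1 / (2 * f * r\<^sup>2)) \<noteq> 0"
    using assms by (simp add: field_simps)
  ultimately show ?thesis
    unfolding is_hyperbola_def by blast
qed

section \<open>Hyperbolic functions\<close>

lemma ex1_hyperbolic_angle:
  fixes p q r :: real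
  assumes "0 < p / r" "p\<^sup>2 - q\<^sup>2 = r\<^sup>2"
  shows "\<exists>!\<theta>. p = r * cosh \<theta> \<and> q = r * sinh \<theta>"
proof -
  have r: "r \<noteq> 0"
    using assms by auto
  have "(p / r)\<^sup>2 = (cosh (arsinh (q / r)))\<^sup>2"
    using assms r by (simp add: cosh_square_eq power_divide field_simps)
  then have "p / r = cosh (arsinh (q / r))"
    using assms(1) by (simp add: power2_eq_iff_nonneg)
  then have "p = r * cosh (arsinh (q / r)) \<and> q = r * sinh (arsinh (q / r))"
    using r by (simp add: field_simps)
  then show ?thesis
    using r by (intro ex1I) (auto simp: arsinh_sinh_real)
qed

lemma cosh_sinh_half_tanh:
  fixes m :: real
  shows "cosh m = (1 + (tanh (m / 2))\<^sup>2) / (1 - (tanh (m / 2))\<^sup>2)"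
    and "sinh m = 2 * tanh (m / 2) / (1 - (tanh (m / 2))\<^sup>2)"
proof -
  have c: "cosh (m / 2) \<noteq> 0"
    using cosh_real_pos[of "m / 2"] by linarith
  have t: "1 - (tanh (m / 2))\<^sup>2 = 1 / (cosh (m / 2))\<^sup>2"
    using c sinh_square_eq[of "m / 2"] by (simp add: tanh_def power_divide diff_divide_distrib)
  show "cosh m = (1 + (tanh (m / 2))\<^sup>2) / (1 - (tanh (m / 2))\<^sup>2)"
    unfolding t using c cosh_double[of "m / 2"] by (simp add: tanh_def field_simps)
  show "sinh m = 2 * tanh (m / 2) / (1 - (tanh (m / 2))\<^sup>2)"
    unfolding t using c sinh_double[of "m / 2"] by (simp add: tanh_def field_simps power2_eq_square)
qed

lemma tanh_artanh:
  fixes x :: real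
  assumes "\<bar>x\<bar> < 1"
  shows "tanh (artanh x) = x"
proof -
  have "0 < (1 + x) / (1 - x)"
    using assms by (simp add: abs_less_iff)
  then have e: "exp (- 2 * artanh x) = (1 - x) / (1 + x)"
    by (simp add: artanh_def exp_minus)
  show ?thesis
    unfolding tanh_real_altdef e using assms by (simp add: abs_less_iff field_simps)
qed

text \<open>
  These are the formulas of \<open>cosh_sinh_half_tanh\<close> with \<open>exp (- \<tau>)\<close> in the place of the half-angle
  tangent: comparing the two shows that \<open>\<bar>tanh (m / 2)\<bar> = exp (- \<tau>)\<close> is the same relation as
  \<open>cosh m = coth \<tau>\<close>.
\<close>

lemma coth_sinh_exp:
  fixes \<tau> :: real
  assumes "0 < \<tau>"
  shows "coth \<tau> = (1 + (exp (- \<tau>))\<^sup>2) / (1 - (exp (- \<tau>))\<^sup>2)"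
    and "1 / sinh \<tau> = 2 * exp (- \<tau>) / (1 - (exp (- \<tau>))\<^sup>2)"
proof -
  define e where "e = exp (- \<tau>)"
  have e: "0 < e" "e < 1" "exp \<tau> = 1 / e"
    using assms by (auto simp: e_def exp_minus field_simps)
  then have e2: "e\<^sup>2 < 1"
    by (simp add: power_less_one_iff)
  have s: "sinh \<tau> = (1 - e\<^sup>2) / (2 * e)" and c: "cosh \<tau> = (1 + e\<^sup>2) / (2 * e)"
    using e by (simp_all add: sinh_field_def cosh_field_def flip: e_def)
      (simp_all add: field_simps power2_eq_square)
  show "coth \<tau> = (1 + (exp (- \<tau>))\<^sup>2) / (1 - (exp (- \<tau>))\<^sup>2)"
    "1 / sinh \<tau> = 2 * exp (- \<tau>) / (1 - (exp (- \<tau>))\<^sup>2)"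
    unfolding coth_def s c using e e2 by (simp_all flip: e_def)
qed

lemma inj_on_coth: "inj_on coth {0<..}"
proof (rule inj_onI)
  fix u v :: real
  assume u: "u \<in> {0<..}" and v: "v \<in> {0<..}" and eq: "coth u = coth v"
  then have "sinh (u - v) = 0"
    by (simp add: coth_def sinh_diff field_simps)
  then show "u = v"
    by simp
qed

text \<open>
  The sign of \<open>m\<close>, which \<open>cosh m\<close> forgets, reappears as the factor that determines \<open>s\<^sub>2\<close>.
\<close>

lemma arcoth_cosh:
  fixes m :: real
  assumes "m \<noteq> 0"
  shows "0 < arcoth (cosh m)" "tanh (m / 2) = sgn m * exp (- arcoth (cosh m))"
proof -
  define r where "r = - ln \<bar>tanh (m / 2)\<bar>"
  have T: "0 < \<bar>tanh (m / 2)\<bar>" "\<bar>tanh (m / 2)\<bar> < 1"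
    using assms tanh_real_lt_1[of "m / 2"] tanh_real_gt_neg1[of "m / 2"] by auto
  have r: "0 < r" "exp (- r) = \<bar>tanh (m / 2)\<bar>"
    using T by (auto simp: r_def)
  have "coth r = cosh m"
    unfolding coth_sinh_exp(1)[OF r(1)] r(2) cosh_sinh_half_tanh(1)[of m] by simp
  then have "arcoth (cosh m) = r"
    unfolding arcoth_def using r(1) by (intro the_inv_into_f_eq inj_on_coth) auto
  moreover have "tanh (m / 2) = sgn m * \<bar>tanh (m / 2)\<bar>"
    using assms by (cases "m > 0") auto
  ultimately show "0 < arcoth (cosh m)" "tanh (m / 2) = sgn m * exp (- arcoth (cosh m))"
    using r by auto
qed

lemma DERIV_coth:
  assumes "u \<noteq> 0"
  shows "(coth has_real_derivative - 1 / (sinh u)\<^sup>2) (at u)"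
proof -
  have "((\<lambda>u. cosh u / sinh u) has_real_derivative
      (sinh u * sinh u - cosh u * cosh u) / (sinh u * sinh u)) (at u)"
    using assms by (auto intro!: derivative_eq_intros)
  moreover have "sinh u * sinh u - cosh u * cosh u = - 1"
    using hyperbolic_pythagoras[of u] by (simp add: power2_eq_square)
  ultimately show ?thesis
    by (simp add: coth_def[abs_def] power2_eq_square)
qed

section \<open>The angle and its maximal interval\<close>

text \<open>
  The first integral \<open>arctan (sinh (\<psi> + \<theta>))\<close> is the Gudermannian of the shifted angle; its range
  \<open>(- \<pi> / 2, \<pi> / 2)\<close> is what bounds the interval of existence on both sides.
\<close>

lemma psi_maximal_neg:
  assumes psi: "maximal_ivp_solution (psi_field \<gamma> \<delta>) \<psi>0 I \<psi>"
    and \<Delta>: "0 < \<Delta>" "\<delta> = \<Delta> * cosh \<theta>" "\<gamma> = \<Delta> * sinh \<theta>"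
  defines "\<rho> \<equiv> arctan (sinh (\<psi>0 + \<theta>))"
  shows "I = {t. - (pi / 2) < \<rho> + \<Delta> * t \<and> \<rho> + \<Delta> * t < pi / 2}"
    and "t \<in> I \<Longrightarrow> sinh (\<psi> t + \<theta>) = tan (\<rho> + \<Delta> * t)"
    and "t \<in> I \<Longrightarrow> cosh (\<psi> t + \<theta>) = 1 / cos (\<rho> + \<Delta> * t)"
proof -
  have sol: "ivp_solution (psi_field \<gamma> \<delta>) \<psi>0 I \<psi>"
    using psi by (simp add: maximal_ivp_solution_def)
  have field: "\<delta> * cosh p + \<gamma> * sinh p = \<Delta> * cosh (p + \<theta>)" for p
    by (simp add: \<Delta> cosh_add algebra_simps)
  have arct: "arctan (sinh (\<psi> t + \<theta>)) = \<rho> + \<Delta> * t" if "t \<in> I" for t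
  proof -
    have "((\<lambda>t. arctan (sinh (\<psi> t + \<theta>)) - \<Delta> * t) has_real_derivative 0) (at t)"
      if "t \<in> I" for t
    proof -
      note d = psi_solution_derivative[OF sol that, unfolded field]
      have "1 + (sinh (\<psi> t + \<theta>))\<^sup>2 = (cosh (\<psi> t + \<theta>))\<^sup>2"
        by (simp add: cosh_square_eq)
      moreover have "cosh (\<psi> t + \<theta>) \<noteq> 0"
        using cosh_real_pos[of "\<psi> t + \<theta>"] by linarith
      ultimately show ?thesis
        by (auto intro!: derivative_eq_intros d simp: divide_simps power2_eq_square)
    qed
    then have "arctan (sinh (\<psi> t + \<theta>)) - \<Delta> * t = arctan (sinh (\<psi> 0 + \<theta>)) - \<Delta> * 0"
      using ivp_solutionD(2,3)[OF sol] that
      by (intro zero_derivative_constant_on_interval[where I = I]) auto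
    then show ?thesis
      using ivp_solutionD(4)[OF sol] by (simp add: \<rho>_def)
  qed
  have range: "- (pi / 2) < \<rho> + \<Delta> * t \<and> \<rho> + \<Delta> * t < pi / 2" if "t \<in> I" for t
    using arctan_bounded[of "sinh (\<psi> t + \<theta>)"] arct[OF that] by auto
  show s: "sinh (\<psi> t + \<theta>) = tan (\<rho> + \<Delta> * t)" if "t \<in> I" for t
    using arct[OF that] by (metis tan_arctan)
  have cosh_inv: "cosh (arsinh (tan u)) = 1 / cos u" if "- (pi / 2) < u \<and> u < pi / 2" for u
  proof -
    have "0 < cos u"
      using that by (simp add: cos_gt_zero_pi)
    then have "(cosh (arsinh (tan u)))\<^sup>2 = (1 / cos u)\<^sup>2"
      using sin_cos_squared_add[of u]
      by (simp add: cosh_square_eq tan_def power_divide field_simps)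
    then show ?thesis
      using \<open>0 < cos u\<close> by (simp add: power2_eq_iff_nonneg)
  qed
  show "cosh (\<psi> t + \<theta>) = 1 / cos (\<rho> + \<Delta> * t)" if "t \<in> I" for t
    using cosh_inv[OF range[OF that]] s[OF that] by (metis arsinh_sinh_real)
  define J where "J = {t. - (pi / 2) < \<rho> + \<Delta> * t \<and> \<rho> + \<Delta> * t < pi / 2}"
  have J: "J = {(- (pi / 2) - \<rho>) / \<Delta> <..< (pi / 2 - \<rho>) / \<Delta>}"
    using \<Delta>(1) by (auto simp: J_def field_simps)
  have "ivp_solution (psi_field \<gamma> \<delta>) \<psi>0 J (\<lambda>t. arsinh (tan (\<rho> + \<Delta> * t)) - \<theta>)"
  proof (rule psi_solutionI)
    show "open J" "is_interval J"
      unfolding J by (auto simp: is_interval_convex_1)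
    show "0 \<in> J"
      using arctan_bounded by (auto simp: J_def \<rho>_def)
    show "arsinh (tan (\<rho> + \<Delta> * 0)) - \<theta> = \<psi>0"
      by (simp add: \<rho>_def tan_arctan arsinh_sinh_real)
    fix t assume "t \<in> J"
    then have bd: "- (pi / 2) < \<rho> + \<Delta> * t \<and> \<rho> + \<Delta> * t < pi / 2"
      by (simp add: J_def)
    then have c: "cos (\<rho> + \<Delta> * t) > 0"
      by (simp add: cos_gt_zero_pi)
    have "sqrt ((tan (\<rho> + \<Delta> * t))\<^sup>2 + 1) = cosh (arsinh (tan (\<rho> + \<Delta> * t)))"
      by (simp add: cosh_arsinh_real)
    then have d: "(arsinh has_real_derivative cos (\<rho> + \<Delta> * t)) (at (tan (\<rho> + \<Delta> * t)))"
      using arsinh_real_has_field_derivative[of "tan (\<rho> + \<Delta> * t)"] cosh_inv[OF bd] by simp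
    show "((\<lambda>t. arsinh (tan (\<rho> + \<Delta> * t)) - \<theta>) has_real_derivative
        \<delta> * cosh (arsinh (tan (\<rho> + \<Delta> * t)) - \<theta>) + \<gamma> * sinh (arsinh (tan (\<rho> + \<Delta> * t)) - \<theta>)) (at t)"
      unfolding field using c
      by (auto intro!: derivative_eq_intros DERIV_chain2[where g = "\<lambda>t. tan (\<rho> + \<Delta> * t)" and x = t, OF d]
          simp: cosh_inv[OF bd] divide_simps power2_eq_square)
  qed
  then show "I = {t. - (pi / 2) < \<rho> + \<Delta> * t \<and> \<rho> + \<Delta> * t < pi / 2}"
    unfolding J_def[symmetric]
  proof (rule maximal_ivp_solution_interval[OF psi])
    fix t assume t: "t \<in> I"
    have "arsinh (tan (\<rho> + \<Delta> * t)) = \<psi> t + \<theta>"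
      using s[OF t] by (metis arsinh_sinh_real)
    then show "t \<in> J \<and> \<psi> t = arsinh (tan (\<rho> + \<Delta> * t)) - \<theta>"
      using range[OF t] by (simp add: J_def)
  qed
qed

lemma psi_field_pos:
  fixes \<gamma> \<delta> \<kappa> \<theta> p :: real
  assumes "\<gamma> = \<kappa> * cosh \<theta>" "\<delta> = \<kappa> * sinh \<theta>"
  shows "\<delta> * cosh p + \<gamma> * sinh p = \<kappa> * sinh (p + \<theta>)"
  unfolding assms sinh_add by (simp add: algebra_simps)

text \<open>
  The substitution \<open>T = tanh (\<mu> / 2)\<close> linearizes \<open>\<mu>' = \<kappa> sinh \<mu>\<close> to \<open>T' = \<kappa> T\<close>.  Unlike
  \<open>arcoth (cosh \<mu>)\<close> it is smooth at \<open>\<mu> = 0\<close>, so it also shows that the equilibrium is kept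
  and that solutions on either side of it never reach it.
\<close>

lemma psi_half_tanh:
  assumes sol: "ivp_solution (psi_field \<gamma> \<delta>) \<psi>0 I \<psi>" and t: "t \<in> I"
    and \<kappa>: "\<gamma> = \<kappa> * cosh \<theta>" "\<delta> = \<kappa> * sinh \<theta>"
  shows "tanh ((\<psi> t + \<theta>) / 2) = tanh ((\<psi>0 + \<theta>) / 2) * exp (\<kappa> * t)"
proof -
  have "((\<lambda>t. tanh ((\<psi> t + \<theta>) / 2) * exp (- \<kappa> * t)) has_real_derivative 0) (at t)"
    if "t \<in> I" for t
  proof -
    note d = psi_solution_derivative[OF sol that, unfolded psi_field_pos[OF \<kappa>]]
    have c: "cosh ((\<psi> t + \<theta>) / 2) \<noteq> 0"
      using cosh_real_pos[of "(\<psi> t + \<theta>) / 2"] by linarith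
    have "(tanh ((\<psi> t + \<theta>) / 2))\<^sup>2 \<noteq> 1"
      using tanh_real_lt_1[of "(\<psi> t + \<theta>) / 2"] tanh_real_gt_neg1[of "(\<psi> t + \<theta>) / 2"]
      by (auto simp: power2_eq_1_iff)
    then have "(1 - (tanh ((\<psi> t + \<theta>) / 2))\<^sup>2) * sinh (\<psi> t + \<theta>) = 2 * tanh ((\<psi> t + \<theta>) / 2)"
      using cosh_sinh_half_tanh(2)[of "\<psi> t + \<theta>"] by simp
    then have e: "(1 - (tanh ((\<psi> t + \<theta>) / 2))\<^sup>2) * (\<kappa> * sinh (\<psi> t + \<theta>)) / 2
        = \<kappa> * tanh ((\<psi> t + \<theta>) / 2)"
      by (metis mult.left_commute nonzero_mult_div_cancel_left zero_neq_numeral)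
    have dexp: "((\<lambda>t. exp (- \<kappa> * t)) has_real_derivative - \<kappa> * exp (- \<kappa> * t)) (at t)"
      by (auto intro!: derivative_eq_intros)
    have dtanh: "((\<lambda>t. tanh ((\<psi> t + \<theta>) / 2)) has_real_derivative \<kappa> * tanh ((\<psi> t + \<theta>) / 2)) (at t)"
      unfolding e[symmetric] by (auto intro!: derivative_eq_intros d c)
    show ?thesis
      using DERIV_mult[OF dtanh dexp] by simp
  qed
  then have "tanh ((\<psi> t + \<theta>) / 2) * exp (- \<kappa> * t)
      = tanh ((\<psi> 0 + \<theta>) / 2) * exp (- \<kappa> * 0)"
    using ivp_solutionD(2,3)[OF sol] t
    by (intro zero_derivative_constant_on_interval[where I = I]) auto
  then show ?thesis
    using ivp_solutionD(4)[OF sol] by (simp add: exp_minus field_simps)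
qed

lemma psi_maximal_pos_equilibrium:
  assumes psi: "maximal_ivp_solution (psi_field \<gamma> \<delta>) \<psi>0 I \<psi>"
    and \<kappa>: "\<gamma> = \<kappa> * cosh \<theta>" "\<delta> = \<kappa> * sinh \<theta>"
    and 0: "\<psi>0 + \<theta> = 0"
  shows "I = UNIV" "\<psi> t + \<theta> = 0"
proof -
  have sol: "ivp_solution (psi_field \<gamma> \<delta>) \<psi>0 I \<psi>"
    using psi by (simp add: maximal_ivp_solution_def)
  have const: "\<psi> t + \<theta> = 0" if "t \<in> I" for t
    using psi_half_tanh[OF sol that \<kappa>] 0 by simp
  have "ivp_solution (psi_field \<gamma> \<delta>) \<psi>0 UNIV (\<lambda>t. - \<theta>)"
    by (rule psi_solutionI) (use 0 in \<open>auto simp: psi_field_pos[OF \<kappa>] simp del: cosh_minus sinh_minus\<close>)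
  then show "I = UNIV"
    by (rule maximal_ivp_solution_interval[OF psi]) (use const in force)
  then show "\<psi> t + \<theta> = 0"
    using const by simp
qed

text \<open>
  For a nonzero initial value, \<open>psi_half_tanh\<close> gives \<open>tanh (\<mu> / 2) = s exp (- \<tau>)\<close> with a fixed sign
  \<open>s\<close>.  Since \<open>tanh\<close> takes values of modulus less than one, \<open>\<tau>\<close> stays positive, and
  \<open>\<mu> = 2 artanh (s exp (- \<tau>))\<close> is a solution as long as it does.
\<close>

lemma psi_maximal_pos:
  assumes psi: "maximal_ivp_solution (psi_field \<gamma> \<delta>) \<psi>0 I \<psi>"
    and \<kappa>: "\<gamma> = \<kappa> * cosh \<theta>" "\<delta> = \<kappa> * sinh \<theta>" "\<kappa> \<noteq> 0"
    and nz: "\<psi>0 + \<theta> \<noteq> 0"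
  defines "\<rho> \<equiv> arcoth (cosh (\<psi>0 + \<theta>))"
  shows "I = {t. \<rho> - \<kappa> * t > 0}"
    and "t \<in> I \<Longrightarrow> cosh (\<psi> t + \<theta>) = coth (\<rho> - \<kappa> * t)"
    and "t \<in> I \<Longrightarrow> sinh (\<psi> t + \<theta>) = sgn (\<psi>0 + \<theta>) / sinh (\<rho> - \<kappa> * t)"
proof -
  define s where "s = sgn (\<psi>0 + \<theta>)"
  have s: "\<bar>s\<bar> = 1" "s\<^sup>2 = 1"
    using nz by (auto simp: s_def sgn_if)
  have sol: "ivp_solution (psi_field \<gamma> \<delta>) \<psi>0 I \<psi>"
    using psi by (simp add: maximal_ivp_solution_def)
  have \<rho>: "0 < \<rho>" "tanh ((\<psi>0 + \<theta>) / 2) = s * exp (- \<rho>)"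
    using arcoth_cosh[OF nz] by (auto simp: \<rho>_def s_def)
  have T: "tanh ((\<psi> t + \<theta>) / 2) = s * exp (- (\<rho> - \<kappa> * t))" if "t \<in> I" for t
    using psi_half_tanh[OF sol that \<kappa>(1,2)] \<rho>(2) by (simp add: exp_diff exp_minus field_simps)
  have pos: "0 < \<rho> - \<kappa> * t" if "t \<in> I" for t
  proof -
    have "\<bar>tanh ((\<psi> t + \<theta>) / 2)\<bar> < 1"
      using tanh_real_lt_1[of "(\<psi> t + \<theta>) / 2"] tanh_real_gt_neg1[of "(\<psi> t + \<theta>) / 2"] by auto
    then show ?thesis
      unfolding T[OF that] by (simp add: abs_mult s)
  qed
  show "cosh (\<psi> t + \<theta>) = coth (\<rho> - \<kappa> * t)" if "t \<in> I" for t
    unfolding cosh_sinh_half_tanh(1)[of "\<psi> t + \<theta>"] T[OF that] coth_sinh_exp(1)[OF pos[OF that]]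
    by (simp add: power_mult_distrib s)
  have "sinh (\<psi> t + \<theta>) = s * (1 / sinh (\<rho> - \<kappa> * t))" if "t \<in> I" for t
    unfolding cosh_sinh_half_tanh(2)[of "\<psi> t + \<theta>"] T[OF that] coth_sinh_exp(2)[OF pos[OF that]]
    by (simp add: power_mult_distrib s)
  then show "sinh (\<psi> t + \<theta>) = sgn (\<psi>0 + \<theta>) / sinh (\<rho> - \<kappa> * t)" if "t \<in> I" for t
    using that by (simp add: s_def)
  define J where "J = {t. \<rho> - \<kappa> * t > 0}"
  define T' where "T' t = s * exp (- (\<rho> - \<kappa> * t))" for t
  have "ivp_solution (psi_field \<gamma> \<delta>) \<psi>0 J (\<lambda>t. 2 * artanh (T' t) - \<theta>)"
  proof (rule psi_solutionI)
    have "J = (if \<kappa> > 0 then {..< \<rho> / \<kappa>} else {\<rho> / \<kappa> <..})"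
      using \<kappa>(3) by (auto simp: J_def field_simps)
    then show "open J" "is_interval J"
      by (auto simp: is_interval_convex_1)
    show "0 \<in> J"
      using \<rho> by (auto simp: J_def)
    have "artanh (T' 0) = (\<psi>0 + \<theta>) / 2"
      unfolding T'_def using \<rho>(2) by (simp add: artanh_tanh_real flip: \<rho>(2))
    then show "2 * artanh (T' 0) - \<theta> = \<psi>0"
      by simp
    fix t assume "t \<in> J"
    then have lt: "\<bar>T' t\<bar> < 1"
      by (simp add: J_def T'_def abs_mult s)
    then have "sinh (2 * artanh (T' t)) = 2 * T' t / (1 - (T' t)\<^sup>2)"
      using cosh_sinh_half_tanh(2)[of "2 * artanh (T' t)"] tanh_artanh[of "T' t"] by simp
    moreover have "(T' has_real_derivative \<kappa> * T' t) (at t)"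
      unfolding T'_def by (auto intro!: derivative_eq_intros)
    ultimately show "((\<lambda>t. 2 * artanh (T' t) - \<theta>) has_real_derivative
        \<delta> * cosh (2 * artanh (T' t) - \<theta>) + \<gamma> * sinh (2 * artanh (T' t) - \<theta>)) (at t)"
      unfolding psi_field_pos[OF \<kappa>(1,2)]
      by (auto intro!: derivative_eq_intros DERIV_chain2[OF artanh_real_has_field_derivative] lt)
  qed
  then show "I = {t. \<rho> - \<kappa> * t > 0}"
    unfolding J_def[symmetric]
  proof (rule maximal_ivp_solution_interval[OF psi])
    fix t assume t: "t \<in> I"
    have "2 * artanh (T' t) = \<psi> t + \<theta>"
      unfolding T'_def T[OF t, symmetric] by (simp add: artanh_tanh_real)
    then show "t \<in> J \<and> \<psi> t = 2 * artanh (T' t) - \<theta>"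
      using pos[OF t] by (simp add: J_def)
  qed
qed

lemma cosh_sgn_sinh:
  fixes s p :: real
  assumes "\<bar>s\<bar> = 1"
  shows "cosh p + s * sinh p = exp (s * p)" "cosh p - s * sinh p = exp (- s * p)"
  using assms by (auto simp: abs_if cosh_plus_sinh cosh_minus_sinh sinh_plus_cosh split: if_splits)

text \<open>
  Now the right-hand side is the single exponential \<open>\<delta> exp (s \<psi>)\<close>, so \<open>exp (- s \<psi>)\<close> is affine in
  \<open>t\<close>; it must stay positive, and the solution exists until it vanishes.
\<close>

lemma psi_maximal_zero:
  assumes psi: "maximal_ivp_solution (psi_field \<gamma> \<delta>) \<psi>0 I \<psi>"
    and s: "\<bar>s\<bar> = 1" "\<gamma> = s * \<delta>" "\<gamma> \<noteq> 0"
  defines "\<rho> \<equiv> exp (- s * \<psi>0)"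
  shows "I = {t. \<rho> - \<gamma> * t > 0}"
    and "t \<in> I \<Longrightarrow> exp (- s * \<psi> t) = \<rho> - \<gamma> * t"
proof -
  have sol: "ivp_solution (psi_field \<gamma> \<delta>) \<psi>0 I \<psi>"
    using psi by (simp add: maximal_ivp_solution_def)
  have field: "\<delta> * cosh p + \<gamma> * sinh p = \<delta> * exp (s * p)" for p
    unfolding cosh_sgn_sinh(1)[OF s(1), symmetric] by (simp add: s(2) algebra_simps)
  have ss: "s * s = 1"
    using s(1) by (auto simp: abs_if split: if_splits)
  show e: "exp (- s * \<psi> t) = \<rho> - \<gamma> * t" if "t \<in> I" for t
  proof -
    have "((\<lambda>t. exp (- s * \<psi> t) + \<gamma> * t) has_real_derivative 0) (at t)" if "t \<in> I" for t
    proof -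
      note d = psi_solution_derivative[OF sol that, unfolded field]
      show ?thesis
        by (auto intro!: derivative_eq_intros d simp: s(2) exp_minus)
    qed
    then have "exp (- s * \<psi> t) + \<gamma> * t = exp (- s * \<psi> 0) + \<gamma> * 0"
      using ivp_solutionD(2,3)[OF sol] that
      by (intro zero_derivative_constant_on_interval[where I = I]) auto
    then show ?thesis
      using ivp_solutionD(4)[OF sol] by (simp add: \<rho>_def)
  qed
  define J where "J = {t. \<rho> - \<gamma> * t > 0}"
  have "ivp_solution (psi_field \<gamma> \<delta>) \<psi>0 J (\<lambda>t. - s * ln (\<rho> - \<gamma> * t))"
  proof (rule psi_solutionI)
    have "J = (if \<gamma> > 0 then {..< \<rho> / \<gamma>} else {\<rho> / \<gamma> <..})"
      using s(3) by (auto simp: J_def field_simps)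
    then show "open J" "is_interval J"
      by (auto simp: is_interval_convex_1)
    show "0 \<in> J"
      by (simp add: J_def \<rho>_def)
    show "- s * ln (\<rho> - \<gamma> * 0) = \<psi>0"
      using ss by (simp add: \<rho>_def flip: mult.assoc)
    fix t assume "t \<in> J"
    then have pos: "\<rho> - \<gamma> * t > 0"
      by (simp add: J_def)
    have "s * (- s * ln (\<rho> - \<gamma> * t)) = - ln (\<rho> - \<gamma> * t)"
      using ss by (simp flip: mult.assoc)
    then have "exp (s * (- s * ln (\<rho> - \<gamma> * t))) = 1 / (\<rho> - \<gamma> * t)"
      unfolding exp_minus using pos by (simp only: exp_minus exp_ln inverse_eq_divide)
    moreover have "s * \<gamma> = \<delta>"
      using ss s(2) by (simp flip: mult.assoc)
    ultimately show "((\<lambda>t. - s * ln (\<rho> - \<gamma> * t)) has_real_derivative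
        \<delta> * cosh (- s * ln (\<rho> - \<gamma> * t)) + \<gamma> * sinh (- s * ln (\<rho> - \<gamma> * t))) (at t)"
      unfolding field using pos
      by (auto intro!: derivative_eq_intros)
  qed
  then show "I = {t. \<rho> - \<gamma> * t > 0}"
    unfolding J_def[symmetric]
  proof (rule maximal_ivp_solution_interval[OF psi])
    fix t assume t: "t \<in> I"
    have pos: "\<rho> - \<gamma> * t > 0"
      unfolding e[OF t, symmetric] by simp
    have "- s * ln (\<rho> - \<gamma> * t) = s * s * \<psi> t"
      unfolding e[OF t, symmetric] by simp
    then show "t \<in> J \<and> \<psi> t = - s * ln (\<rho> - \<gamma> * t)"
      using pos ss by (simp add: J_def)
  qed
qed

section \<open>The three kinds of curves\<close>

text \<open>
  The hypotheses on \<open>\<alpha>\<close> and \<open>\<beta>\<close> say \<open>x' = y (l \<psi>' + \<nu> y' / y)\<close>.  The first summand integrates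
  to the tangent and the second to \<open>y\<close> itself, so \<open>(x - \<nu> (y - 1)) / l\<close> equals
  \<open>cos \<rho> (tan \<tau> - tan \<rho>)\<close>.  This function of \<open>t\<close> also gives injectivity, which \<open>y\<close> alone does not.
\<close>

lemma curve_neg:
  assumes psi: "maximal_ivp_solution (psi_field \<gamma> \<delta>) \<psi>0 I \<psi>"
    and \<Delta>: "0 < \<Delta>" "\<delta> = \<Delta> * cosh \<theta>" "\<gamma> = \<Delta> * sinh \<theta>"
    and coeff: "\<alpha> = l * \<delta> + \<nu> * \<gamma>" "\<beta> = l * \<gamma> + \<nu> * \<delta>" "l \<noteq> 0"
  defines "\<rho> \<equiv> arctan (sinh (\<psi>0 + \<theta>))"
  defines "c \<equiv> (\<lambda>t. (cos \<rho> * (l * (tan (\<rho> + \<Delta> * t) - tan \<rho>)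
                          + \<nu> * (1 / cos (\<rho> + \<Delta> * t) - 1 / cos \<rho>)),
                     cos \<rho> / cos (\<rho> + \<Delta> * t)))"
  shows "I = {t. - (pi / 2) < \<rho> + \<Delta> * t \<and> \<rho> + \<Delta> * t < pi / 2}"
    and "unique_ivp_solution (xy_field \<alpha> \<beta> \<gamma> \<delta> \<psi>) (0, 1) I c"
    and "arc_of_hyperbola I c {(X, Y). Y\<^sup>2 - ((X - \<nu> * (Y - 1)) / l + sin \<rho>)\<^sup>2 = (cos \<rho>)\<^sup>2}"
proof -
  have sol: "ivp_solution (psi_field \<gamma> \<delta>) \<psi>0 I \<psi>"
    using psi by (simp add: maximal_ivp_solution_def)
  note psi_facts = psi_maximal_neg[OF psi \<Delta>, folded \<rho>_def]
  show I: "I = {t. - (pi / 2) < \<rho> + \<Delta> * t \<and> \<rho> + \<Delta> * t < pi / 2}"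
    by (rule psi_facts(1))
  have cos0: "cos (\<rho> + \<Delta> * t) > 0" if "t \<in> I" for t
    using that unfolding I by (auto intro: cos_gt_zero_pi)
  have cos\<rho>: "cos \<rho> > 0"
    using cos0[OF ivp_solutionD(3)[OF sol]] by simp
  have fields: "\<delta> * cosh p + \<gamma> * sinh p = \<Delta> * cosh (p + \<theta>)"
    "\<gamma> * cosh p + \<delta> * sinh p = \<Delta> * sinh (p + \<theta>)" for p
    by (simp_all add: \<Delta> cosh_add sinh_add algebra_simps)
  have field_x: "\<alpha> * cosh p + \<beta> * sinh p
      = l * (\<Delta> * cosh (p + \<theta>)) + \<nu> * (\<Delta> * sinh (p + \<theta>))" for p
    unfolding fields[symmetric] coeff by (simp add: algebra_simps)
  show uniq: "unique_ivp_solution (xy_field \<alpha> \<beta> \<gamma> \<delta> \<psi>) (0, 1) I c"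
    unfolding c_def
  proof (rule xy_unique_solution)
    fix t assume t: "t \<in> I"
    note cos0[OF t]
    moreover have "sin (\<rho> + \<Delta> * t) = tan (\<rho> + \<Delta> * t) * cos (\<rho> + \<Delta> * t)"
      using cos0[OF t] by (simp add: tan_def)
    ultimately show "((\<lambda>t. cos \<rho> * (l * (tan (\<rho> + \<Delta> * t) - tan \<rho>)
          + \<nu> * (1 / cos (\<rho> + \<Delta> * t) - 1 / cos \<rho>))) has_real_derivative
        cos \<rho> / cos (\<rho> + \<Delta> * t) * (\<alpha> * cosh (\<psi> t) + \<beta> * sinh (\<psi> t))) (at t)"
      and "((\<lambda>t. cos \<rho> / cos (\<rho> + \<Delta> * t)) has_real_derivative
        cos \<rho> / cos (\<rho> + \<Delta> * t) * (\<gamma> * cosh (\<psi> t) + \<delta> * sinh (\<psi> t))) (at t)"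
      unfolding field_x fields psi_facts(2,3)[OF t]
      by (auto intro!: derivative_eq_intros simp: field_simps power2_eq_square)
    show "cos \<rho> / cos (\<rho> + \<Delta> * t) \<noteq> 0"
      using cos0[OF t] cos\<rho> by simp
  qed (simp_all add: ivp_solutionD(1-3)[OF sol] less_imp_neq[OF cos\<rho>, symmetric])
  have w: "(fst (c t) - \<nu> * (snd (c t) - 1)) / l = cos \<rho> * (tan (\<rho> + \<Delta> * t) - tan \<rho>)"
    for t
  proof -
    have "cos \<rho> * (1 / cos (\<rho> + \<Delta> * t) - 1 / cos \<rho>) = cos \<rho> / cos (\<rho> + \<Delta> * t) - 1"
      using cos\<rho> by (simp add: algebra_simps)
    then have "fst (c t) - \<nu> * (snd (c t) - 1) = l * (cos \<rho> * (tan (\<rho> + \<Delta> * t) - tan \<rho>))"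
      using cos\<rho> by (simp add: c_def algebra_simps)
    then show ?thesis
      using coeff(3) by simp
  qed
  show "arc_of_hyperbola I c
      {(X, Y). Y\<^sup>2 - ((X - \<nu> * (Y - 1)) / l + sin \<rho>)\<^sup>2 = (cos \<rho>)\<^sup>2}"
  proof (rule arc_of_hyperbolaI[OF _ uniq])
    show "is_hyperbola {(X, Y). Y\<^sup>2 - ((X - \<nu> * (Y - 1)) / l + sin \<rho>)\<^sup>2 = (cos \<rho>)\<^sup>2}"
      using coeff(3) cos\<rho> by (intro is_hyperbola_vertical) auto
    show "inj_on c I"
    proof (rule inj_onI)
      fix t u assume t: "t \<in> I" and u: "u \<in> I" and "c t = c u"
      then have "tan (\<rho> + \<Delta> * t) = tan (\<rho> + \<Delta> * u)"
        using w[of t] w[of u] cos\<rho> by simp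
      then have "arctan (tan (\<rho> + \<Delta> * t)) = arctan (tan (\<rho> + \<Delta> * u))"
        by simp
      then show "t = u"
        using t u \<Delta>(1) unfolding I by (simp add: arctan_tan)
    qed
    fix t assume t: "t \<in> I"
    have "(fst (c t) - \<nu> * (snd (c t) - 1)) / l + sin \<rho> = cos \<rho> * tan (\<rho> + \<Delta> * t)"
      unfolding w using cos\<rho> by (simp add: tan_def algebra_simps)
    moreover have "(snd (c t))\<^sup>2 - (cos \<rho> * tan (\<rho> + \<Delta> * t))\<^sup>2 = (cos \<rho>)\<^sup>2"
      using cos0[OF t]
      by (simp add: c_def tan_def power_divide power_mult_distrib sin_squared_eq field_simps)
    ultimately show "c t \<in> {(X, Y). Y\<^sup>2 - ((X - \<nu> * (Y - 1)) / l + sin \<rho>)\<^sup>2 = (cos \<rho>)\<^sup>2}"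
      by (simp add: case_prod_beta)
  qed
qed

lemma fields_pos:
  fixes \<gamma> \<delta> \<kappa> \<theta> p :: real
  assumes "\<gamma> = \<kappa> * cosh \<theta>" "\<delta> = \<kappa> * sinh \<theta>"
    and "\<alpha> = - (l * \<delta> + \<nu> * \<gamma>)" "\<beta> = - (l * \<gamma> + \<nu> * \<delta>)"
  shows "\<gamma> * cosh p + \<delta> * sinh p = \<kappa> * cosh (p + \<theta>)"
    and "\<alpha> * cosh p + \<beta> * sinh p = - (l * (\<kappa> * sinh (p + \<theta>)) + \<nu> * (\<kappa> * cosh (p + \<theta>)))"
proof -
  show y: "\<gamma> * cosh p + \<delta> * sinh p = \<kappa> * cosh (p + \<theta>)"
    unfolding assms(1,2) cosh_add by (simp add: algebra_simps)
  show "\<alpha> * cosh p + \<beta> * sinh p = - (l * (\<kappa> * sinh (p + \<theta>)) + \<nu> * (\<kappa> * cosh (p + \<theta>)))"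
    unfolding y[symmetric] psi_field_pos[OF assms(1,2), symmetric] assms(3,4)
    by (simp add: algebra_simps)
qed

lemma curve_pos_equilibrium:
  assumes psi: "maximal_ivp_solution (psi_field \<gamma> \<delta>) \<psi>0 I \<psi>"
    and \<kappa>: "\<gamma> = \<kappa> * cosh \<theta>" "\<delta> = \<kappa> * sinh \<theta>" "\<kappa> \<noteq> 0"
    and coeff: "\<alpha> = - (l * \<delta> + \<nu> * \<gamma>)" "\<beta> = - (l * \<gamma> + \<nu> * \<delta>)"
    and 0: "\<psi>0 + \<theta> = 0"
  defines "c \<equiv> (\<lambda>t. (- \<nu> * (exp (\<kappa> * t) - 1), exp (\<kappa> * t)))"
  shows "unique_ivp_solution (xy_field \<alpha> \<beta> \<gamma> \<delta> \<psi>) (0, 1) I c"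
    and "c ` I = {(X, Y). Y > 0 \<and> X + \<nu> * (Y - 1) = 0}"
proof -
  note const = psi_maximal_pos_equilibrium[OF psi \<kappa>(1,2) 0]
  show "unique_ivp_solution (xy_field \<alpha> \<beta> \<gamma> \<delta> \<psi>) (0, 1) I c"
    unfolding c_def
  proof (rule xy_unique_solution)
    fix t
    show "((\<lambda>t. - \<nu> * (exp (\<kappa> * t) - 1)) has_real_derivative
        exp (\<kappa> * t) * (\<alpha> * cosh (\<psi> t) + \<beta> * sinh (\<psi> t))) (at t)"
      and "((\<lambda>t. exp (\<kappa> * t)) has_real_derivative
        exp (\<kappa> * t) * (\<gamma> * cosh (\<psi> t) + \<delta> * sinh (\<psi> t))) (at t)"
      unfolding fields_pos[OF \<kappa>(1,2) coeff] const(2)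
      by (auto intro!: derivative_eq_intros)
  qed (auto simp: const(1))
  show "c ` I = {(X, Y). Y > 0 \<and> X + \<nu> * (Y - 1) = 0}"
  proof (intro equalityI subsetI)
    fix z assume "z \<in> {(X, Y). Y > 0 \<and> X + \<nu> * (Y - 1) = 0}"
    then have "snd z > 0" "fst z = - \<nu> * (snd z - 1)"
      by (auto simp: algebra_simps)
    then have "z = c (ln (snd z) / \<kappa>)"
      using \<kappa>(3) by (simp add: c_def prod_eq_iff)
    then show "z \<in> c ` I"
      by (auto simp: const(1))
  qed (auto simp: c_def)
qed

text \<open>
  Here \<open>x' = - y (l \<psi>' + \<nu> y' / y)\<close>.  The shifted angle has \<open>sinh \<mu> = - s / sinh \<tau>\<close>, whence the
  sign in the \<open>l\<close>-part of \<open>x\<close>; the combination isolating this part satisfies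
  \<open>s w + cosh \<rho> = y cosh \<tau>\<close>, and the equation of the hyperbola is \<open>cosh\<^sup>2 \<tau> - 1 = sinh\<^sup>2 \<tau>\<close>
  multiplied by \<open>y\<^sup>2\<close>.
\<close>

lemma curve_pos:
  assumes psi: "maximal_ivp_solution (psi_field \<gamma> \<delta>) \<psi>0 I \<psi>"
    and \<kappa>: "\<gamma> = \<kappa> * cosh \<theta>" "\<delta> = \<kappa> * sinh \<theta>" "\<kappa> \<noteq> 0"
    and coeff: "\<alpha> = - (l * \<delta> + \<nu> * \<gamma>)" "\<beta> = - (l * \<gamma> + \<nu> * \<delta>)" "l \<noteq> 0"
    and nz: "\<psi>0 + \<theta> \<noteq> 0"
  defines "\<rho> \<equiv> arcoth (cosh (\<psi>0 + \<theta>))"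
  defines "s \<equiv> - sgn (\<psi>0 + \<theta>)"
  defines "c \<equiv> (\<lambda>t. (sinh \<rho> * (\<nu> * (1 / sinh \<rho> - 1 / sinh (\<rho> - \<kappa> * t))
                          + s * l * (coth (\<rho> - \<kappa> * t) - coth \<rho>)),
                     sinh \<rho> / sinh (\<rho> - \<kappa> * t)))"
  shows "I = {t. \<rho> - \<kappa> * t > 0}"
    and "unique_ivp_solution (xy_field \<alpha> \<beta> \<gamma> \<delta> \<psi>) (0, 1) I c"
    and "arc_of_hyperbola I c
      {(X, Y). (s * ((X + \<nu> * (Y - 1)) / l) + cosh \<rho>)\<^sup>2 - Y\<^sup>2 = (sinh \<rho>)\<^sup>2}"
proof -
  have sol: "ivp_solution (psi_field \<gamma> \<delta>) \<psi>0 I \<psi>"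
    using psi by (simp add: maximal_ivp_solution_def)
  note psi_facts = psi_maximal_pos[OF psi \<kappa> nz, folded \<rho>_def]
  show I: "I = {t. \<rho> - \<kappa> * t > 0}"
    by (rule psi_facts(1))
  have \<rho>: "\<rho> > 0"
    using ivp_solutionD(3)[OF sol] by (simp add: I)
  have s: "s * s = 1" "s \<noteq> 0" "sgn (\<psi>0 + \<theta>) = - s"
    using nz by (auto simp: s_def sgn_if)
  show uniq: "unique_ivp_solution (xy_field \<alpha> \<beta> \<gamma> \<delta> \<psi>) (0, 1) I c"
    unfolding c_def
  proof (rule xy_unique_solution)
    fix t assume t: "t \<in> I"
    then have \<tau>: "\<rho> - \<kappa> * t > 0"
      by (simp add: I)
    then have sinh: "sinh (\<rho> - \<kappa> * t) \<noteq> 0"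
      by simp
    have lin: "((\<lambda>t. \<rho> - \<kappa> * t) has_real_derivative - \<kappa>) (at t)"
      by (auto intro!: derivative_eq_intros)
    have dcoth: "((\<lambda>t. coth (\<rho> - \<kappa> * t)) has_real_derivative \<kappa> / (sinh (\<rho> - \<kappa> * t))\<^sup>2) (at t)"
      using DERIV_chain2[where g = "\<lambda>t. \<rho> - \<kappa> * t", OF DERIV_coth lin] \<tau> by simp
    have dsinh: "((\<lambda>t. 1 / sinh (\<rho> - \<kappa> * t)) has_real_derivative
        \<kappa> * cosh (\<rho> - \<kappa> * t) / (sinh (\<rho> - \<kappa> * t))\<^sup>2) (at t)"
      using sinh by (auto intro!: derivative_eq_intros simp: power2_eq_square)
    show "((\<lambda>t. sinh \<rho> * (\<nu> * (1 / sinh \<rho> - 1 / sinh (\<rho> - \<kappa> * t))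
          + s * l * (coth (\<rho> - \<kappa> * t) - coth \<rho>))) has_real_derivative
        sinh \<rho> / sinh (\<rho> - \<kappa> * t) * (\<alpha> * cosh (\<psi> t) + \<beta> * sinh (\<psi> t))) (at t)"
      unfolding fields_pos[OF \<kappa>(1,2) coeff(1,2)] psi_facts(2,3)[OF t] s(3)
      by (rule DERIV_cong[OF DERIV_cmult[OF DERIV_add[OF
                DERIV_cmult[OF DERIV_diff[OF DERIV_const dsinh]]
                DERIV_cmult[OF DERIV_diff[OF dcoth DERIV_const]]]]])
        (use sinh in \<open>simp add: coth_def field_simps power2_eq_square\<close>)
    show "((\<lambda>t. sinh \<rho> / sinh (\<rho> - \<kappa> * t)) has_real_derivative
        sinh \<rho> / sinh (\<rho> - \<kappa> * t) * (\<gamma> * cosh (\<psi> t) + \<delta> * sinh (\<psi> t))) (at t)"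
      unfolding fields_pos[OF \<kappa>(1,2) coeff(1,2)] psi_facts(2)[OF t]
      using DERIV_cmult[OF dsinh, of "sinh \<rho>"]
      by (simp add: coth_def power2_eq_square mult.commute)
    show "sinh \<rho> / sinh (\<rho> - \<kappa> * t) \<noteq> 0"
      using \<rho> \<tau> by simp
  qed (simp_all add: ivp_solutionD(1-3)[OF sol] less_imp_neq[OF \<rho>, symmetric])
  have w: "s * ((fst (c t) + \<nu> * (snd (c t) - 1)) / l) + cosh \<rho> = snd (c t) * cosh (\<rho> - \<kappa> * t)"
    for t
  proof -
    have "sinh \<rho> * (1 / sinh \<rho> - 1 / sinh (\<rho> - \<kappa> * t)) = 1 - sinh \<rho> / sinh (\<rho> - \<kappa> * t)"
      using \<rho> by (simp add: algebra_simps)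
    then have "fst (c t) + \<nu> * (snd (c t) - 1)
        = s * l * (sinh \<rho> * (coth (\<rho> - \<kappa> * t) - coth \<rho>))"
      using \<rho> by (simp add: c_def algebra_simps)
    then have "s * ((fst (c t) + \<nu> * (snd (c t) - 1)) / l)
        = sinh \<rho> * (coth (\<rho> - \<kappa> * t) - coth \<rho>)"
      using coeff(3) s(1) by (simp flip: mult.assoc)
    then show ?thesis
      using \<rho> by (simp add: coth_def c_def algebra_simps)
  qed
  show "arc_of_hyperbola I c
      {(X, Y). (s * ((X + \<nu> * (Y - 1)) / l) + cosh \<rho>)\<^sup>2 - Y\<^sup>2 = (sinh \<rho>)\<^sup>2}"
  proof (rule arc_of_hyperbolaI[OF _ uniq])
    show "is_hyperbola {(X, Y). (s * ((X + \<nu> * (Y - 1)) / l) + cosh \<rho>)\<^sup>2 - Y\<^sup>2 = (sinh \<rho>)\<^sup>2}"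
      using coeff(3) s(2) \<rho> by (intro is_hyperbola_horizontal) auto
    show "inj_on c I"
    proof (rule inj_onI)
      fix t u assume "t \<in> I" "u \<in> I" "c t = c u"
      then have "sinh (\<rho> - \<kappa> * t) = sinh (\<rho> - \<kappa> * u)"
        using \<rho> unfolding I c_def by (simp add: field_simps)
      then have "\<rho> - \<kappa> * t = \<rho> - \<kappa> * u"
        by (metis arsinh_sinh_real)
      then show "t = u"
        using \<kappa>(3) by simp
    qed
    fix t assume "t \<in> I"
    then have "sinh (\<rho> - \<kappa> * t) \<noteq> 0"
      by (simp add: I)
    then have "(snd (c t) * cosh (\<rho> - \<kappa> * t))\<^sup>2 - (snd (c t))\<^sup>2 = (sinh \<rho>)\<^sup>2"
      using cosh_square_eq[of "\<rho> - \<kappa> * t"]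
      by (simp add: c_def power_divide power_mult_distrib field_simps)
    then show "c t \<in> {(X, Y). (s * ((X + \<nu> * (Y - 1)) / l) + cosh \<rho>)\<^sup>2 - Y\<^sup>2 = (sinh \<rho>)\<^sup>2}"
      by (simp add: case_prod_beta w del: times_divide_eq_right)
  qed
qed

text \<open>
  In terms of \<open>exp (s \<psi>) = 1 / \<tau>\<close> and \<open>exp (- s \<psi>) = \<tau>\<close> the equations read \<open>y' = \<gamma> y / \<tau>\<close> and
  \<open>x' = - \<gamma> y (g / \<tau> + f \<tau>)\<close>.  The \<open>g\<close>-part contributes a multiple of \<open>y - 1\<close> to \<open>x\<close> and the
  \<open>f\<close>-part, as \<open>y \<tau> = \<rho>\<close> is constant, an affine function of \<open>\<tau> = \<rho> / y\<close>.
\<close>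

lemma curve_zero:
  assumes psi: "maximal_ivp_solution (psi_field \<gamma> \<delta>) \<psi>0 I \<psi>"
    and s: "\<bar>s\<bar> = 1" "\<gamma> = s * \<delta>" "\<gamma> \<noteq> 0"
    and coeff: "\<alpha> = - \<gamma> * (f + g)" "\<beta> = s * \<gamma> * (f - g)" "f \<noteq> 0"
  defines "\<rho> \<equiv> exp (- s * \<psi>0)"
  defines "c \<equiv> (\<lambda>t. (\<rho> * (f * (\<rho> - \<gamma> * t - \<rho>) + g * (1 / \<rho> - 1 / (\<rho> - \<gamma> * t))),
                     \<rho> / (\<rho> - \<gamma> * t)))"
  shows "I = {t. \<rho> - \<gamma> * t > 0}"
    and "unique_ivp_solution (xy_field \<alpha> \<beta> \<gamma> \<delta> \<psi>) (0, 1) I c"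
    and "arc_of_hyperbola I c {(X, Y). Y \<noteq> 0 \<and> (X + g * (Y - 1)) / f = \<rho>\<^sup>2 * (1 / Y - 1)}"
proof -
  have sol: "ivp_solution (psi_field \<gamma> \<delta>) \<psi>0 I \<psi>"
    using psi by (simp add: maximal_ivp_solution_def)
  note psi_facts = psi_maximal_zero[OF psi s, folded \<rho>_def]
  show I: "I = {t. \<rho> - \<gamma> * t > 0}"
    by (rule psi_facts(1))
  have \<rho>: "\<rho> > 0"
    by (simp add: \<rho>_def)
  have ss: "s * s = 1"
    using s(1) by (auto simp: abs_if split: if_splits)
  have "s * \<gamma> = \<delta>"
    using ss s(2) by (simp flip: mult.assoc)
  then have field_y: "\<gamma> * cosh p + \<delta> * sinh p = \<gamma> * exp (s * p)" for p
    unfolding cosh_sgn_sinh(1)[OF s(1), symmetric] by (auto simp: algebra_simps)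
  have field_x: "\<alpha> * cosh p + \<beta> * sinh p = - \<gamma> * (f * exp (- s * p) + g * exp (s * p))" for p
    unfolding cosh_sgn_sinh[OF s(1), symmetric] coeff by (simp add: algebra_simps)
  show uniq: "unique_ivp_solution (xy_field \<alpha> \<beta> \<gamma> \<delta> \<psi>) (0, 1) I c"
    unfolding c_def
  proof (rule xy_unique_solution)
    fix t assume t: "t \<in> I"
    then have \<tau>: "\<rho> - \<gamma> * t > 0"
      by (simp add: I)
    have "exp (s * \<psi> t) = 1 / exp (- s * \<psi> t)"
      by (simp add: exp_minus inverse_eq_divide)
    then have exps: "exp (s * \<psi> t) = 1 / (\<rho> - \<gamma> * t)"
      unfolding psi_facts(2)[OF t] .
    have lin: "((\<lambda>t. \<rho> - \<gamma> * t) has_real_derivative - \<gamma>) (at t)"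
      by (auto intro!: derivative_eq_intros)
    have alg: "\<rho> * (f * (- \<gamma> - 0) + g * (0 - \<gamma> / u\<^sup>2))
        = \<rho> / u * (- \<gamma> * (f * u + g * (1 / u)))" if "u \<noteq> 0" for u
      using that by (simp add: field_simps power2_eq_square)
    have dinv: "((\<lambda>t. 1 / (\<rho> - \<gamma> * t)) has_real_derivative \<gamma> / (\<rho> - \<gamma> * t)\<^sup>2) (at t)"
      using \<tau> by (auto intro!: derivative_eq_intros simp: power2_eq_square)
    show "((\<lambda>t. \<rho> * (f * (\<rho> - \<gamma> * t - \<rho>) + g * (1 / \<rho> - 1 / (\<rho> - \<gamma> * t))))
        has_real_derivative \<rho> / (\<rho> - \<gamma> * t) * (\<alpha> * cosh (\<psi> t) + \<beta> * sinh (\<psi> t))) (at t)"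
      unfolding field_x exps psi_facts(2)[OF t]
      by (rule DERIV_cong[OF DERIV_cmult[OF DERIV_add[OF
                DERIV_cmult[OF DERIV_diff[OF lin DERIV_const]]
                DERIV_cmult[OF DERIV_diff[OF DERIV_const dinv]]]]])
        (rule alg, use \<tau> in simp)
    show "((\<lambda>t. \<rho> / (\<rho> - \<gamma> * t)) has_real_derivative
        \<rho> / (\<rho> - \<gamma> * t) * (\<gamma> * cosh (\<psi> t) + \<delta> * sinh (\<psi> t))) (at t)"
      unfolding field_y exps
      using DERIV_cmult[OF dinv, of \<rho>] by (simp add: power2_eq_square mult.commute)
    show "\<rho> / (\<rho> - \<gamma> * t) \<noteq> 0"
      using \<rho> \<tau> by simp
  qed (simp_all add: ivp_solutionD(1-3)[OF sol] less_imp_neq[OF \<rho>, symmetric])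
  show "arc_of_hyperbola I c {(X, Y). Y \<noteq> 0 \<and> (X + g * (Y - 1)) / f = \<rho>\<^sup>2 * (1 / Y - 1)}"
  proof (rule arc_of_hyperbolaI[OF _ uniq])
    show "is_hyperbola {(X, Y). Y \<noteq> 0 \<and> (X + g * (Y - 1)) / f = \<rho>\<^sup>2 * (1 / Y - 1)}"
      using coeff(3) \<rho> by (intro is_hyperbola_rectangular) auto
    show "inj_on c I"
    proof (rule inj_onI)
      fix t u assume "t \<in> I" "u \<in> I" "c t = c u"
      then have "\<rho> - \<gamma> * t = \<rho> - \<gamma> * u"
        using \<rho> unfolding I c_def by (simp add: frac_eq_eq)
      then show "t = u"
        using s(3) by simp
    qed
    fix t assume "t \<in> I"
    then have \<tau>: "\<rho> - \<gamma> * t > 0"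
      by (simp add: I)
    have "\<rho> * (1 / \<rho> - 1 / (\<rho> - \<gamma> * t)) = 1 - \<rho> / (\<rho> - \<gamma> * t)"
      using \<rho> by (simp add: algebra_simps)
    then have "fst (c t) + g * (snd (c t) - 1) = f * (\<rho> * (\<rho> - \<gamma> * t - \<rho>))"
      using \<rho> by (simp add: c_def algebra_simps)
    moreover have "\<rho> * (\<rho> - \<gamma> * t - \<rho>) = \<rho>\<^sup>2 * (1 / snd (c t) - 1)"
      using \<rho> \<tau> by (simp add: c_def field_simps power2_eq_square)
    ultimately have "(fst (c t) + g * (snd (c t) - 1)) / f = \<rho>\<^sup>2 * (1 / snd (c t) - 1)"
      using coeff(3) by simp
    moreover have "snd (c t) \<noteq> 0"
      using \<rho> \<tau> by (simp add: c_def)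
    ultimately show "c t \<in> {(X, Y). Y \<noteq> 0 \<and> (X + g * (Y - 1)) / f = \<rho>\<^sup>2 * (1 / Y - 1)}"
      by (simp add: case_prod_beta)
  qed
qed

section \<open>The curves through the identity\<close>

text \<open>
  The first quantity is the determinant of the inverse, and Cramer's rule expresses \<open>\<delta>\<close> by it.
  So \<open>a \<ge> 0\<close> means \<open>\<delta> \<ge> 0\<close>, and the determinant makes the coefficients \<open>\<lambda>\<close> and \<open>f\<close> nonzero.
\<close>

lemma inverse_entries:
  fixes A :: "real^2^2"
  assumes A: "A = vector [vector [a, b], vector [c, d]]"
    and inv: "matrix_inv A = vector [vector [\<alpha>, \<beta>], vector [\<gamma>, \<delta>]]"
    and det: "det A > 0"
  shows "\<alpha> * \<delta> - \<beta> * \<gamma> > 0" "\<delta> = a * (\<alpha> * \<delta> - \<beta> * \<gamma>)"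
proof -
  have "invertible A"
    using det by (simp add: invertible_det_nz)
  then have "A ** matrix_inv A = mat 1"
    unfolding invertible_def matrix_inv_def by (rule someI2_ex) blast
  then have e: "(A ** matrix_inv A) $ i $ j = mat 1 $ i $ j" for i j
    by simp
  have prod: "a * \<alpha> + b * \<gamma> = 1" "a * \<beta> + b * \<delta> = 0" "c * \<alpha> + d * \<gamma> = 0" "c * \<beta> + d * \<delta> = 1"
    using e[of 1 1] e[of 1 2] e[of 2 1] e[of 2 2]
    unfolding inv unfolding A by (simp_all add: matrix_matrix_mult_def sum_2 mat_def)
  have "det A * (\<alpha> * \<delta> - \<beta> * \<gamma>)
      = (a * \<alpha> + b * \<gamma>) * (c * \<beta> + d * \<delta>) - (a * \<beta> + b * \<delta>) * (c * \<alpha> + d * \<gamma>)"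
    by (simp add: A det_2 algebra_simps)
  then have "det A * (\<alpha> * \<delta> - \<beta> * \<gamma>) = 1"
    by (simp add: prod)
  then show "\<alpha> * \<delta> - \<beta> * \<gamma> > 0"
    using det by (metis zero_less_mult_pos zero_less_one)
  have "a * (\<alpha> * \<delta> - \<beta> * \<gamma>) = (a * \<alpha> + b * \<gamma>) * \<delta> - (a * \<beta> + b * \<delta>) * \<gamma>"
    by (simp add: algebra_simps)
  then show "\<delta> = a * (\<alpha> * \<delta> - \<beta> * \<gamma>)"
    by (simp add: prod)
qed

text \<open>
  For \<open>q \<noteq> 0\<close> the vectors \<open>(\<delta>, \<gamma>)\<close> and \<open>(\<gamma>, \<delta>)\<close> form a basis of the plane, and the
  coefficients come from Cramer's rule.  In the two cases \<open>q\<close> is \<open>\<Delta>\<^sup>2\<close> or \<open>- \<Delta>\<^sup>2\<close>, which explains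
  the opposite signs of the two kinds of curves.
\<close>

lemma row_decomposition:
  fixes \<gamma> \<delta> :: real
  assumes "\<delta>\<^sup>2 - \<gamma>\<^sup>2 = q" "q \<noteq> 0"
  shows "\<alpha> = (\<alpha> * \<delta> - \<beta> * \<gamma>) / q * \<delta> + (\<beta> * \<delta> - \<alpha> * \<gamma>) / q * \<gamma>"
    and "\<beta> = (\<alpha> * \<delta> - \<beta> * \<gamma>) / q * \<gamma> + (\<beta> * \<delta> - \<alpha> * \<gamma>) / q * \<delta>"
proof -
  have "(\<alpha> * \<delta> - \<beta> * \<gamma>) * \<delta> + (\<beta> * \<delta> - \<alpha> * \<gamma>) * \<gamma> = \<alpha> * q"
    "(\<alpha> * \<delta> - \<beta> * \<gamma>) * \<gamma> + (\<beta> * \<delta> - \<alpha> * \<gamma>) * \<delta> = \<beta> * q"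
    unfolding assms(1)[symmetric] by (simp_all add: power2_eq_square algebra_simps)
  then show "\<alpha> = (\<alpha> * \<delta> - \<beta> * \<gamma>) / q * \<delta> + (\<beta> * \<delta> - \<alpha> * \<gamma>) / q * \<gamma>"
    "\<beta> = (\<alpha> * \<delta> - \<beta> * \<gamma>) / q * \<gamma> + (\<beta> * \<delta> - \<alpha> * \<gamma>) / q * \<delta>"
    using assms(2) by (simp_all flip: add_divide_distrib)
qed

theorem proposition4:
  fixes a b c d \<alpha> \<beta> \<gamma> \<delta> K \<psi>0 :: real
    and A :: "real^2^2"
    and \<psi> :: "real \<Rightarrow> real"
    and I :: "real set"
  assumes A: "A = vector [vector [a, b], vector [c, d]]"
    and det: "det A > 0"
    and a: "a \<ge> 0"
    and inv: "matrix_inv A = vector [vector [\<alpha>, \<beta>], vector [\<gamma>, \<delta>]]"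
    and K: "K = \<gamma>\<^sup>2 - \<delta>\<^sup>2"
    and psi: "maximal_ivp_solution (psi_field \<gamma> \<delta>) \<psi>0 I \<psi>"
  shows
    "(K < 0 \<longrightarrow>
       (let \<Delta> = sqrt (\<delta>\<^sup>2 - \<gamma>\<^sup>2);
            \<theta> = (THE \<theta>. \<delta> = \<Delta> * cosh \<theta> \<and> \<gamma> = \<Delta> * sinh \<theta>);
            lam = (\<alpha> * \<delta> - \<beta> * \<gamma>) / \<Delta>\<^sup>2;
            \<nu> = (\<beta> * \<delta> - \<alpha> * \<gamma>) / \<Delta>\<^sup>2;
            \<rho> = arctan (sinh (\<psi>0 + \<theta>));
            \<tau> = (\<lambda>t. \<rho> + \<Delta> * t);
            x = (\<lambda>t. cos \<rho> * (lam * (tan (\<tau> t) - tan \<rho>) + \<nu> * (1 / cos (\<tau> t) - 1 / cos \<rho>)));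
            y = (\<lambda>t. cos \<rho> / cos (\<tau> t));
            w = (\<lambda>X Y. (X - \<nu> * (Y - 1)) / lam)
        in I = {t. - (pi / 2) < \<tau> t \<and> \<tau> t < pi / 2} \<and>
           unique_ivp_solution (xy_field \<alpha> \<beta> \<gamma> \<delta> \<psi>) (0, 1) I (\<lambda>t. (x t, y t)) \<and>
           arc_of_hyperbola I (\<lambda>t. (x t, y t))
             {(X, Y). Y\<^sup>2 - (w X Y + sin \<rho>)\<^sup>2 = (cos \<rho>)\<^sup>2})) \<and>
     (K > 0 \<longrightarrow>
       (let \<Delta> = sqrt (\<gamma>\<^sup>2 - \<delta>\<^sup>2);
            s1 = sgn \<gamma>;
            \<theta> = (THE \<theta>. \<gamma> = s1 * \<Delta> * cosh \<theta> \<and> \<delta> = s1 * \<Delta> * sinh \<theta>);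
            lam = (\<alpha> * \<delta> - \<beta> * \<gamma>) / \<Delta>\<^sup>2;
            \<nu> = (\<beta> * \<delta> - \<alpha> * \<gamma>) / \<Delta>\<^sup>2;
            \<mu>0 = \<psi>0 + \<theta>
        in (\<mu>0 = 0 \<longrightarrow>
             (let \<sigma> = (\<lambda>t. s1 * \<Delta> * t);
                  x = (\<lambda>t. - \<nu> * (exp (\<sigma> t) - 1));
                  y = (\<lambda>t. exp (\<sigma> t))
              in unique_ivp_solution (xy_field \<alpha> \<beta> \<gamma> \<delta> \<psi>) (0, 1) I (\<lambda>t. (x t, y t)) \<and>
                 (\<lambda>t. (x t, y t)) ` I = {(X, Y). Y > 0 \<and> X + \<nu> * (Y - 1) = 0})) \<and>
           (\<mu>0 \<noteq> 0 \<longrightarrow>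
             (let \<rho> = arcoth (cosh \<mu>0);
                  \<tau> = (\<lambda>t. \<rho> - s1 * \<Delta> * t);
                  s2 = - sgn \<mu>0;
                  x = (\<lambda>t. sinh \<rho> * (\<nu> * (1 / sinh \<rho> - 1 / sinh (\<tau> t))
                             + s2 * lam * (coth (\<tau> t) - coth \<rho>)));
                  y = (\<lambda>t. sinh \<rho> / sinh (\<tau> t));
                  w = (\<lambda>X Y. (X + \<nu> * (Y - 1)) / lam)
              in I = {t. \<tau> t > 0} \<and>
                 unique_ivp_solution (xy_field \<alpha> \<beta> \<gamma> \<delta> \<psi>) (0, 1) I (\<lambda>t. (x t, y t)) \<and>
                 arc_of_hyperbola I (\<lambda>t. (x t, y t))
                   {(X, Y). (s2 * w X Y + cosh \<rho>)\<^sup>2 - Y\<^sup>2 = (sinh \<rho>)\<^sup>2})))) \<and>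
     (K = 0 \<longrightarrow>
       (let s1 = sgn \<gamma>;
            f = - ((\<alpha> - s1 * \<beta>) / (2 * \<gamma>));
            g = - ((\<alpha> + s1 * \<beta>) / (2 * \<gamma>));
            \<rho> = exp (- s1 * \<psi>0);
            \<tau> = (\<lambda>t. \<rho> - \<gamma> * t);
            x = (\<lambda>t. \<rho> * (f * (\<tau> t - \<rho>) + g * (1 / \<rho> - 1 / \<tau> t)));
            y = (\<lambda>t. \<rho> / \<tau> t);
            w = (\<lambda>X Y. (X + g * (Y - 1)) / f)
        in I = {t. \<tau> t > 0} \<and>
           unique_ivp_solution (xy_field \<alpha> \<beta> \<gamma> \<delta> \<psi>) (0, 1) I (\<lambda>t. (x t, y t)) \<and>
           arc_of_hyperbola I (\<lambda>t. (x t, y t))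
             {(X, Y). Y \<noteq> 0 \<and> w X Y = \<rho>\<^sup>2 * (1 / Y - 1)}))"
proof -
  have D: "\<alpha> * \<delta> - \<beta> * \<gamma> > 0" and \<delta>: "\<delta> \<ge> 0"
  proof -
    show "\<alpha> * \<delta> - \<beta> * \<gamma> > 0"
      by (rule inverse_entries(1)[OF A inv det])
    then have "a * (\<alpha> * \<delta> - \<beta> * \<gamma>) \<ge> 0"
      using a by simp
    then show "\<delta> \<ge> 0"
      using inverse_entries(2)[OF A inv det] by linarith
  qed
  show ?thesis
  proof (intro conjI impI, goal_cases)
    \<comment> \<open>\<open>K < 0\<close>, where \<open>\<delta> \<ge> 0\<close> and \<open>\<delta>\<^sup>2 > \<gamma>\<^sup>2\<close> give \<open>\<delta> > 0\<close>, so that the hyperbolic angle exists\<close>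
    case 1
    define \<Delta> where "\<Delta> = sqrt (\<delta>\<^sup>2 - \<gamma>\<^sup>2)"
    define \<theta> where "\<theta> = (THE \<theta>. \<delta> = \<Delta> * cosh \<theta> \<and> \<gamma> = \<Delta> * sinh \<theta>)"
    define l where "l = (\<alpha> * \<delta> - \<beta> * \<gamma>) / \<Delta>\<^sup>2"
    define \<nu> where "\<nu> = (\<beta> * \<delta> - \<alpha> * \<gamma>) / \<Delta>\<^sup>2"
    have \<Delta>: "\<Delta> > 0" "\<delta>\<^sup>2 - \<gamma>\<^sup>2 = \<Delta>\<^sup>2"
      using \<open>K < 0\<close> K by (simp_all add: \<Delta>_def)
    have "\<delta> \<noteq> 0"
    proof
      assume "\<delta> = 0"
      then have "\<Delta>\<^sup>2 = - \<gamma>\<^sup>2"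
        using \<Delta>(2) by simp
      moreover have "\<Delta>\<^sup>2 > 0"
        using \<Delta>(1) by simp
      ultimately show False
        using zero_le_power2[of \<gamma>] by linarith
    qed
    then have "\<exists>!\<theta>. \<delta> = \<Delta> * cosh \<theta> \<and> \<gamma> = \<Delta> * sinh \<theta>"
      using \<Delta> \<delta> by (intro ex1_hyperbolic_angle) auto
    from theI'[OF this] have \<theta>: "\<delta> = \<Delta> * cosh \<theta>" "\<gamma> = \<Delta> * sinh \<theta>"
      unfolding \<theta>_def[symmetric] by (rule conjunct1, rule conjunct2)
    have coeff: "\<alpha> = l * \<delta> + \<nu> * \<gamma>" "\<beta> = l * \<gamma> + \<nu> * \<delta>"
      unfolding l_def \<nu>_def using row_decomposition[OF \<Delta>(2)] \<Delta>(1) by simp_all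
    have "l \<noteq> 0"
      using D \<Delta>(1) by (simp add: l_def)
    note res = curve_neg[OF psi \<Delta>(1) \<theta> coeff this]
    show ?case
      unfolding Let_def \<Delta>_def[symmetric] unfolding \<theta>_def[symmetric] l_def[symmetric] \<nu>_def[symmetric]
      by (intro conjI res)
  next
    \<comment> \<open>\<open>K > 0\<close>, with the signed constant \<open>sgn \<gamma> * \<Delta>\<close> as \<open>\<kappa>\<close>\<close>
    case 2
    define \<Delta> where "\<Delta> = sqrt (\<gamma>\<^sup>2 - \<delta>\<^sup>2)"
    define \<theta> where "\<theta> = (THE \<theta>. \<gamma> = sgn \<gamma> * \<Delta> * cosh \<theta> \<and> \<delta> = sgn \<gamma> * \<Delta> * sinh \<theta>)"
    define l where "l = (\<alpha> * \<delta> - \<beta> * \<gamma>) / \<Delta>\<^sup>2"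
    define \<nu> where "\<nu> = (\<beta> * \<delta> - \<alpha> * \<gamma>) / \<Delta>\<^sup>2"
    have \<Delta>: "\<Delta> > 0" "\<gamma>\<^sup>2 - \<delta>\<^sup>2 = \<Delta>\<^sup>2"
      using \<open>K > 0\<close> K by (simp_all add: \<Delta>_def)
    have "\<gamma> \<noteq> 0"
      using \<open>K > 0\<close> K by auto
    then have "\<gamma> / (sgn \<gamma> * \<Delta>) > 0" "(sgn \<gamma> * \<Delta>)\<^sup>2 = \<Delta>\<^sup>2" and \<kappa>: "sgn \<gamma> * \<Delta> \<noteq> 0"
      using \<Delta>(1) by (auto simp: sgn_if intro: divide_neg_pos)
    then have "\<exists>!\<theta>. \<gamma> = sgn \<gamma> * \<Delta> * cosh \<theta> \<and> \<delta> = sgn \<gamma> * \<Delta> * sinh \<theta>"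
      using \<Delta>(2) by (intro ex1_hyperbolic_angle) auto
    from theI'[OF this] have \<theta>: "\<gamma> = sgn \<gamma> * \<Delta> * cosh \<theta>" "\<delta> = sgn \<gamma> * \<Delta> * sinh \<theta>"
      unfolding \<theta>_def[symmetric] by (rule conjunct1, rule conjunct2)
    have "\<delta>\<^sup>2 - \<gamma>\<^sup>2 = - \<Delta>\<^sup>2"
      using \<Delta>(2) by simp
    from row_decomposition[OF this]
    have coeff: "\<alpha> = - (l * \<delta> + \<nu> * \<gamma>)" "\<beta> = - (l * \<gamma> + \<nu> * \<delta>)"
      unfolding l_def \<nu>_def using \<Delta>(1) by simp_all
    have l: "l \<noteq> 0"
      using D \<Delta>(1) by (simp add: l_def)
    show ?case
      unfolding Let_def \<Delta>_def[symmetric] unfolding \<theta>_def[symmetric] l_def[symmetric] \<nu>_def[symmetric]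
      by (intro conjI impI curve_pos_equilibrium[OF psi \<theta> \<kappa> coeff] curve_pos[OF psi \<theta> \<kappa> coeff l])
  next
    \<comment> \<open>\<open>K = 0\<close>, where \<open>\<gamma> = 0\<close> would make the second row vanish\<close>
    case 3
    define f where "f = - ((\<alpha> - sgn \<gamma> * \<beta>) / (2 * \<gamma>))"
    define g where "g = - ((\<alpha> + sgn \<gamma> * \<beta>) / (2 * \<gamma>))"
    have abs: "\<bar>\<gamma>\<bar> = \<delta>"
      using \<open>K = 0\<close> K \<delta> by (auto simp: power2_eq_iff abs_if)
    then have "\<gamma> \<noteq> 0"
      using D by auto
    then have s: "\<bar>sgn \<gamma>\<bar> = 1" "\<gamma> = sgn \<gamma> * \<delta>" "sgn \<gamma> * sgn \<gamma> = 1"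
      using abs by (auto simp: sgn_if)
    have coeff: "\<alpha> = - \<gamma> * (f + g)" "\<beta> = sgn \<gamma> * \<gamma> * (f - g)"
      using \<open>\<gamma> \<noteq> 0\<close> s(1) by (auto simp: f_def g_def sgn_if field_simps)
    have "\<alpha> * \<delta> - \<beta> * \<gamma> = \<delta> * (\<alpha> - sgn \<gamma> * \<beta>)"
      using s(2) by (simp add: algebra_simps)
    then have "f \<noteq> 0"
      using D \<open>\<gamma> \<noteq> 0\<close> by (auto simp: f_def)
    note res = curve_zero[OF psi s(1,2) \<open>\<gamma> \<noteq> 0\<close> coeff this]
    show ?case
      unfolding Let_def f_def[symmetric] g_def[symmetric]
      by (intro conjI res)
  qed
qed

end
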